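(* Let $D_f$ be an $f$-divergence with $f$ strictly convex. Let $p$ be an elliptically symmetric density on $\mathbb{R}^d$ with point of even symmetry $\mu$, and let $\mathcal{Q}=\{q_{\nu,S}\}$ be an elliptical location-scale family on $\mathbb{R}^d$ with location parameter $\nu\in\mathbb{R}^d$ and scale matrix $S$. Suppose that $p$ and every $q\in\mathcal{Q}$ are strictly unimodal. Then, for every scale matrix $S$, the function $\nu\mapsto D_f(p\|q_{\nu,S})$ on $\mathbb{R}^d$ has a unique minimizer, and it occurs at $\nu=\mu$.
   Context: **$f$-divergence.** For probability densities $p,q$ (w.r.t. Lebesgue measure, strictly positive on $\mathbb{R}^d$), $D_f(p\|q)=\int f\left(\frac{p(z)}{q(z)}\right)q(z)\,dz$, where $f:[0,\infty)\to\mathbb{R}\cup\{+\infty\}$ is finite on $(0,\infty)$, convex, $f(1)=0$, and $\lim_{u\to0^+}f(u)=f(0)$. It is assumed that $f$ is differentiable on $(0,\infty)$. **Elliptical symmetry.** A density $p$ on $\mathbb{R}^d$ is elliptically symmetric about $\mu$ if there is a positive-definite matrix $M$ with $\mathrm{trace}(M)=d$ (the scatter matrix) such that $p(z)=p(z')$ whenever $(z-\mu)^\top M^{-1}(z-\mu)=(z'-\mu)^\top M^{-1}(z'-\mu)$. Equivalently, for any matrix $C$ with $C^\top C=M^{-1}$, $p(z)=g_p(\|C(z-\mu)\|)\,|C|$ for a function $g_p:[0,\infty)\to[0,\infty)$, the radial function of $p$ ($|C|$ is the absolute value of the determinant). The point $\mu$ is the point of even symmetry: $p(\mu+\zeta)=p(\mu-\zeta)$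 for all $\zeta$. **Strictly unimodal.** An elliptical density is strictly unimodal if its radial function is strictly decreasing. **Elliptical location-scale family.** $\mathcal{Q}=\{q_{\nu,S}:\nu\in\mathbb{R}^d,\ S \text{ symmetric positive-definite}\}$ with $q_{\nu,S}(z)=g_q(\|C(z-\nu)\|)\,|C|$ for any $C$ with $C^\top C=S^{-1}$, where $g_q$ is a fixed radial function not depending on $(\nu,S)$. **Standing regularity assumptions.** $p$ is differentiable, $D_f(p\|q)$ is finite for each $q\in\mathcal{Q}$, and differentiation with respect to the variational parameters can be interchanged with integration: writing $S=BB^\top$ with $B$ invertible and $$D_f(p\|q_{\nu,S})=\int f\left(\frac{p(\nu+B\zeta)\,|B|}{g_q(\|\zeta\|)}\right)g_q(\|\zeta\|)\,d\zeta,$$ the partial derivatives of the integrand with respect to $(\nu,B)$ are, locally in $(\nu,B)$, dominated by an integrable function of $\zeta$. *)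

theory Defs
  imports "HOL-Analysis.Analysis"
begin

definition convex_ereal :: "(real \<Rightarrow> ereal) \<Rightarrow> bool" where
  "convex_ereal f \<longleftrightarrow>
    (\<forall>u\<ge>0. \<forall>v\<ge>0. \<forall>t. 0 \<le> t \<and> t \<le> 1 \<longrightarrow>
      f (t * u + (1 - t) * v) \<le> ereal t * f u + ereal (1 - t) * f v)"

text \<open>If \<open>f 0 = \<infinity>\<close>, the inequality for an endpoint \<open>0\<close> reads \<open>f w < \<infinity>\<close> with \<open>w > 0\<close>, so strict
  convexity is a genuine condition only where \<open>f\<close> is finite.\<close>

definition strictly_convex_ereal :: "(real \<Rightarrow> ereal) \<Rightarrow> bool" where
  "strictly_convex_ereal f \<longleftrightarrow>
    (\<forall>u\<ge>0. \<forall>v\<ge>0. \<forall>t. u \<noteq> v \<and> 0 < t \<and> t < 1 \<longrightarrow>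
      f (t * u + (1 - t) * v) < ereal t * f u + ereal (1 - t) * f v)"

text \<open>The generator lives on \<open>[0, \<infinity>)\<close>; its values at negative arguments are irrelevant.\<close>

definition divergence_generator :: "(real \<Rightarrow> ereal) \<Rightarrow> bool" where
  "divergence_generator f \<longleftrightarrow>
    f 0 \<noteq> -\<infinity> \<and> (\<forall>u>0. \<bar>f u\<bar> \<noteq> \<infinity>) \<and> convex_ereal f \<and> f 1 = 0 \<and>
    (f \<longlongrightarrow> f 0) (at_right 0) \<and>
    (\<lambda>u. real_of_ereal (f u)) differentiable_on {0<..}"

definition prob_density :: "(real ^ 'n \<Rightarrow> real) \<Rightarrow> bool" where
  "prob_density p \<longleftrightarrow> (\<forall>z. 0 < p z) \<and> has_bochner_integral lborel p 1"

text \<open>The extended-real Lebesgue integral of \<open>f (p z / q z) * q z\<close>, as the integral of the positive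
  part minus that of the negative part (\<open>e2ennreal\<close> sends negative values to \<open>0\<close>). Since
  \<open>\<infinity> - \<infinity> = \<infinity>\<close> in \<open>ereal\<close>, a finite value means that both parts have finite integral.\<close>

definition f_divergence ::
    "(real \<Rightarrow> ereal) \<Rightarrow> (real ^ 'n \<Rightarrow> real) \<Rightarrow> (real ^ 'n \<Rightarrow> real) \<Rightarrow> ereal" where
  "f_divergence f p q =
    enn2ereal (\<integral>\<^sup>+ z. e2ennreal (f (p z / q z) * ereal (q z)) \<partial>lborel) -
    enn2ereal (\<integral>\<^sup>+ z. e2ennreal (- (f (p z / q z) * ereal (q z))) \<partial>lborel)"

definition pos_def_matrix :: "real ^ 'n ^ 'n \<Rightarrow> bool" where
  "pos_def_matrix M \<longleftrightarrow> transpose M = M \<and> (\<forall>x. x \<noteq> 0 \<longrightarrow> 0 < x \<bullet> (M *v x))"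

definition scatter_matrix :: "(real ^ 'n \<Rightarrow> real) \<Rightarrow> real ^ 'n \<Rightarrow> real ^ 'n ^ 'n \<Rightarrow> bool" where
  "scatter_matrix p \<mu> M \<longleftrightarrow>
    pos_def_matrix M \<and> trace M = real CARD('n) \<and>
    (\<forall>z z'. (z - \<mu>) \<bullet> (matrix_inv M *v (z - \<mu>)) = (z' - \<mu>) \<bullet> (matrix_inv M *v (z' - \<mu>)) \<longrightarrow>
      p z = p z')"

definition elliptically_symmetric :: "(real ^ 'n \<Rightarrow> real) \<Rightarrow> real ^ 'n \<Rightarrow> bool" where
  "elliptically_symmetric p \<mu> \<longleftrightarrow> (\<exists>M. scatter_matrix p \<mu> M)"

text \<open>\<open>g\<close> is the radial function of \<open>p\<close> with respect to location \<open>\<mu>\<close> and matrix \<open>M\<close>; only its values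
  on \<open>[0, \<infinity>)\<close> matter. The matrices \<open>C\<close> differ by a left orthogonal factor, so the choice of \<open>C\<close> does
  not affect the formula.\<close>

definition radial_function ::
    "(real ^ 'n \<Rightarrow> real) \<Rightarrow> real ^ 'n \<Rightarrow> real ^ 'n ^ 'n \<Rightarrow> (real \<Rightarrow> real) \<Rightarrow> bool" where
  "radial_function p \<mu> M g \<longleftrightarrow>
    (\<forall>r\<ge>0. 0 \<le> g r) \<and>
    (\<forall>C. transpose C ** C = matrix_inv M \<longrightarrow>
      (\<forall>z. p z = g (norm (C *v (z - \<mu>))) * \<bar>det C\<bar>))"

definition strictly_unimodal :: "(real ^ 'n \<Rightarrow> real) \<Rightarrow> real ^ 'n \<Rightarrow> bool" where
  "strictly_unimodal p \<mu> \<longleftrightarrow>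
    (\<exists>M g. scatter_matrix p \<mu> M \<and> radial_function p \<mu> M g \<and> strict_antimono_on {0..} g)"

text \<open>\<open>q \<nu> S\<close> is the member with location \<open>\<nu>\<close> and scale matrix \<open>S\<close>. The scale matrix is not
  normalised to \<open>trace S = CARD('n)\<close>, unlike a scatter matrix.\<close>

definition elliptical_location_scale_family ::
    "(real \<Rightarrow> real) \<Rightarrow> (real ^ 'n \<Rightarrow> real ^ 'n ^ 'n \<Rightarrow> real ^ 'n \<Rightarrow> real) \<Rightarrow> bool" where
  "elliptical_location_scale_family g q \<longleftrightarrow>
    (\<forall>\<nu> S. pos_def_matrix S \<longrightarrow> prob_density (q \<nu> S) \<and> radial_function (q \<nu> S) \<nu> S g)"

text \<open>The integrand of \<open>f_divergence f p (q \<nu> S)\<close> after the substitution \<open>z = \<nu> + B *v \<zeta>\<close>, where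
  \<open>S = B ** transpose B\<close>, as a function of the parameters \<open>\<theta> = (\<nu>, B)\<close>. For invertible \<open>B\<close> the
  argument of \<open>f\<close> is positive, so \<open>real_of_ereal\<close> loses nothing.\<close>

definition reparam_integrand ::
    "(real \<Rightarrow> ereal) \<Rightarrow> (real ^ 'n \<Rightarrow> real) \<Rightarrow> (real \<Rightarrow> real) \<Rightarrow>
      (real ^ 'n) \<times> (real ^ 'n ^ 'n) \<Rightarrow> real ^ 'n \<Rightarrow> real" where
  "reparam_integrand f p g \<theta> \<zeta> =
    real_of_ereal (f (p (fst \<theta> + snd \<theta> *v \<zeta>) * \<bar>det (snd \<theta>)\<bar> / g (norm \<zeta>))) * g (norm \<zeta>)"

text \<open>Near every \<open>(\<nu>, B)\<close> with \<open>B\<close> invertible, all partial derivatives of the integrand (one for each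
  entry of \<open>\<nu>\<close> and of \<open>B\<close>, that is, for each element of the standard basis of the parameter space)
  are dominated by an integrable function of \<open>\<zeta>\<close>.\<close>

definition locally_dominated_partials ::
    "(real \<Rightarrow> ereal) \<Rightarrow> (real ^ 'n \<Rightarrow> real) \<Rightarrow> (real \<Rightarrow> real) \<Rightarrow> bool" where
  "locally_dominated_partials f p g \<longleftrightarrow>
    (\<forall>\<theta>\<^sub>0. invertible (snd \<theta>\<^sub>0) \<longrightarrow>
      (\<exists>\<epsilon>>0. \<exists>h. integrable lborel h \<and>
        (AE \<zeta> in lborel. \<forall>\<theta>\<in>ball \<theta>\<^sub>0 \<epsilon>. \<forall>b\<in>Basis.
          \<bar>deriv (\<lambda>t. reparam_integrand f p g (\<theta> + t *\<^sub>R b) \<zeta>) 0\<bar> \<le> h \<zeta>)))"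

end

theory Submission
  imports Defs
begin

text \<open>The quadratic forms of \<open>M\<^sup>-\<^sup>1\<close> and \<open>S\<^sup>-\<^sup>1\<close> have a common orthogonal basis. For each vector \<open>b\<close> of
  it, the oblique reflections along \<open>b\<close> preserve both families of ellipsoids, so a two-point
  symmetrization, based on the strict submodularity of \<open>(a, u) \<mapsto> u f(a / u)\<close>, shows that removing the
  \<open>b\<close>-component of \<open>\<nu> - \<mu>\<close> strictly decreases the divergence unless that component is \<open>0\<close>.
  Removing all components moves \<open>\<nu>\<close> to \<open>\<mu>\<close>.\<close>

section \<open>Spectral theorem and positive definite matrices\<close>

text \<open>A maximizer \<open>e\<close> of the quadratic form \<open>x \<bullet> T x\<close> on the
  unit sphere of \<open>V\<close> exists by compactness. Perturbing it along the residual
  \<open>w = T e - l *\<^sub>R e\<close>, which lies in \<open>V\<close>, would raise the form to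
  first order unless \<open>w = 0\<close>.\<close>

lemma selfadjoint_eigenvector:
  fixes T :: "'a::euclidean_space \<Rightarrow> 'a"
  assumes lin: "linear T" and sa: "\<And>x y. T x \<bullet> y = x \<bullet> T y"
    and V: "subspace V" "T ` V \<subseteq> V" "V \<noteq> {0}"
  obtains e l where "e \<in> V" "norm e = 1" "T e = l *\<^sub>R e"
proof -
  let ?K = "sphere 0 1 \<inter> V"
  have "compact ?K"
    using closed_subspace[OF V(1)] by (intro compact_Int_closed) auto
  moreover have "?K \<noteq> {}"
  proof -
    obtain v where v: "v \<in> V" "v \<noteq> 0"
      using V(1,3) subspace_0 by blast
    then have "inverse (norm v) *\<^sub>R v \<in> ?K"
      using V(1) by (auto simp: subspace_scale)
    then show ?thesis by blast
  qed
  moreover have "continuous_on ?K (\<lambda>x. x \<bullet> T x)"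
    using lin by (intro continuous_intros linear_continuous_on) (simp add: linear_conv_bounded_linear)
  ultimately obtain e where e: "e \<in> V" "norm e = 1" and max: "\<And>y. y \<in> ?K \<Longrightarrow> y \<bullet> T y \<le> e \<bullet> T e"
    using continuous_attains_sup[of ?K "\<lambda>x. x \<bullet> T x"] that by (metis Int_iff mem_sphere_0)
  define l where "l = e \<bullet> T e"
  have bound: "v \<bullet> T v \<le> l * (v \<bullet> v)" if "v \<in> V" for v
  proof (cases "v = 0")
    case False
    then have "(inverse (norm v) *\<^sub>R v) \<bullet> T (inverse (norm v) *\<^sub>R v) \<le> l"
      unfolding l_def using that V(1) by (intro max) (auto simp: subspace_scale)
    then show ?thesis
      using False by (simp add: linear_scale[OF lin] dot_square_norm field_simps power2_eq_square)
  qed (simp add: linear_0[OF lin])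
  define w where "w = T e - l *\<^sub>R e"
  define k where "k = l * (w \<bullet> w) - w \<bullet> T w"
  have wV: "w \<in> V"
    unfolding w_def using e V by (auto intro!: subspace_diff subspace_scale)
  have ww: "w \<bullet> T e = w \<bullet> w + l * (w \<bullet> e)"
    by (simp add: w_def algebra_simps)
  \<comment> \<open>This is \<open>bound\<close> at \<open>e + t *\<^sub>R w\<close>: the terms in
    \<open>w \<bullet> e\<close> cancel, which leaves a term linear in \<open>t\<close> against a
    quadratic one.\<close>
  have quad: "2 * t * (w \<bullet> w) \<le> t\<^sup>2 * k" for t
  proof -
    have "(e + t *\<^sub>R w) \<bullet> T (e + t *\<^sub>R w) \<le> l * ((e + t *\<^sub>R w) \<bullet> (e + t *\<^sub>R w))"
      using e wV V(1) by (intro bound) (auto intro!: subspace_add subspace_scale)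
    moreover have "(e + t *\<^sub>R w) \<bullet> T (e + t *\<^sub>R w) = l + 2 * t * (w \<bullet> T e) + t\<^sup>2 * (w \<bullet> T w)"
      using sa[of e w] by (simp add: linear_add[OF lin] linear_scale[OF lin] inner_add l_def
          inner_commute algebra_simps power2_eq_square)
    moreover have "(e + t *\<^sub>R w) \<bullet> (e + t *\<^sub>R w) = 1 + 2 * t * (w \<bullet> e) + t\<^sup>2 * (w \<bullet> w)"
      using e(2) by (simp add: norm_eq_1 inner_add inner_commute algebra_simps power2_eq_square)
    ultimately have "l + 2 * t * (w \<bullet> T e) + t\<^sup>2 * (w \<bullet> T w) \<le> l * (1 + 2 * t * (w \<bullet> e) + t\<^sup>2 * (w \<bullet> w))"
      by metis
    then show ?thesis
      by (simp add: ww k_def algebra_simps)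
  qed
  have k0: "k \<ge> 0"
    using bound[OF wV] by (simp add: k_def)
  have "w \<bullet> w = 0"
  proof (rule ccontr)
    assume "w \<bullet> w \<noteq> 0"
    then have pos: "w \<bullet> w > 0"
      by simp
    \<comment> \<open>Small enough for the linear term to win; the denominator is
      \<open>k + 1\<close> because \<open>k\<close> may be 0.\<close>
    define t where "t = (w \<bullet> w) / (k + 1)"
    have t: "t > 0" "t * (k + 1) = w \<bullet> w"
      using pos k0 by (simp_all add: t_def)
    have "t * (2 * (t * (k + 1))) \<le> t * (t * k)"
      using quad[of t] t(2) by (simp add: power2_eq_square mult.assoc mult.left_commute)
    then have "2 * (k + 1) \<le> k"
      using t(1) by (simp add: mult.left_commute)
    with k0 show False by simp
  qed
  then have "T e = l *\<^sub>R e"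
    by (simp add: w_def)
  with e that show ?thesis by blast
qed

text \<open>Induction on the dimension: split off one unit eigenvector \<open>e\<close>. By
  self-adjointness its orthogonal complement within \<open>V\<close> is again invariant under
  \<open>T\<close>, and it has smaller dimension.\<close>

lemma selfadjoint_eigenbasis_subspace:
  fixes T :: "'a::euclidean_space \<Rightarrow> 'a"
  assumes lin: "linear T" and sa: "\<And>x y. T x \<bullet> y = x \<bullet> T y"
    and "subspace V" "T ` V \<subseteq> V"
  shows "\<exists>B. finite B \<and> pairwise orthogonal B \<and> span B = V \<and>
    (\<forall>b\<in>B. norm b = 1 \<and> (\<exists>l. T b = l *\<^sub>R b))"
  using assms(3,4)
proof (induction "dim V" arbitrary: V rule: less_induct)
  case less
  show ?case
  proof (cases "V = {0}")
    case True
    then show ?thesis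
      by (intro exI[of _ "{}"]) auto
  next
    case False
    obtain e l where e: "e \<in> V" "norm e = 1" "T e = l *\<^sub>R e"
      using selfadjoint_eigenvector[OF lin sa less.prems False] by blast
    define W where "W = V \<inter> {x. e \<bullet> x = 0}"
    have W: "subspace W"
      unfolding W_def using less.prems(1) by (intro subspace_inter subspace_hyperplane)
    have "e \<bullet> T x = 0" if "e \<bullet> x = 0" for x
      using sa[of e x] that by (simp add: e(3))
    then have TW: "T ` W \<subseteq> W"
      using less.prems(2) by (auto simp: W_def)
    have "e \<notin> W"
      using e(2) by (auto simp: W_def dot_square_norm)
    moreover have "W \<subseteq> V"
      by (auto simp: W_def)
    ultimately have "W \<subset> V"
      using e(1) by blast
    then have "dim W < dim V"
      using W less.prems(1) by (intro dim_psubset) (simp add: span_eq_iff[THEN iffD2])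
    then obtain B where B: "finite B" "pairwise orthogonal B" "span B = W"
      "\<forall>b\<in>B. norm b = 1 \<and> (\<exists>l. T b = l *\<^sub>R b)"
      using less.hyps W TW by blast
    have orth: "e \<bullet> b = 0" if "b \<in> B" for b
      using span_base[OF that] B(3) by (auto simp: W_def)
    have "span (insert e B) = V"
    proof
      show "span (insert e B) \<subseteq> V"
        using e(1) B(3) span_superset[of B] less.prems(1) by (intro span_minimal) (auto simp: W_def)
      show "V \<subseteq> span (insert e B)"
      proof
        fix x assume x: "x \<in> V"
        have "x - (e \<bullet> x) *\<^sub>R e \<in> span B"
          unfolding B(3) W_def using x e less.prems(1)
          by (auto intro!: subspace_diff subspace_scale simp: inner_diff dot_square_norm)
        then show "x \<in> span (insert e B)"
          unfolding span_insert by blast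
      qed
    qed
    moreover have "pairwise orthogonal (insert e B)"
      using B(2) orth by (auto simp: pairwise_insert orthogonal_def inner_commute)
    ultimately show ?thesis
      using B e by (intro exI[of _ "insert e B"]) auto
  qed
qed

lemma symmetric_matrix_eigenbasis:
  fixes A :: "real ^ 'n ^ 'n"
  assumes "transpose A = A"
  shows "\<exists>B. finite B \<and> pairwise orthogonal B \<and> span B = UNIV \<and>
    (\<forall>b\<in>B. norm b = 1 \<and> (\<exists>l. A *v b = l *\<^sub>R b))"
proof -
  have "(A *v x) \<bullet> y = x \<bullet> (A *v y)" for x y
    using assms by (metis dot_lmul_matrix transpose_matrix_vector)
  then show ?thesis
    using selfadjoint_eigenbasis_subspace[of "(*v) A" UNIV] by (simp add: matrix_vector_mul_linear)
qed

lemma symmetric_matrix_inner: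
  fixes A :: "real ^ 'n ^ 'n"
  assumes "transpose A = A"
  shows "(A *v x) \<bullet> y = x \<bullet> (A *v y)"
  using assms by (metis dot_lmul_matrix transpose_matrix_vector)

lemma symmetric_matrixI:
  fixes A :: "real ^ 'n ^ 'n"
  assumes "\<And>x y. (A *v x) \<bullet> y = x \<bullet> (A *v y)"
  shows "transpose A = A"
proof -
  have "(transpose A *v y) \<bullet> x = (A *v y) \<bullet> x" for x y
    using assms[of y x] by (simp add: transpose_matrix_vector dot_lmul_matrix)
  then show ?thesis
    by (metis matrix_eq vector_eq_rdot)
qed

lemma pos_def_matrix_invertible:
  assumes "pos_def_matrix M"
  shows "invertible M"
proof -
  have "x = 0" if "M *v x = 0" for x
    using assms that by (metis inner_zero_right less_irrefl pos_def_matrix_def)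
  then show ?thesis
    using invertible_left_inverse matrix_left_invertible_ker by blast
qed

lemma matrix_inv_mult:
  fixes M :: "real ^ 'n ^ 'n"
  assumes "invertible M"
  shows "M ** matrix_inv M = mat 1" "matrix_inv M ** M = mat 1"
  using someI_ex[OF assms[unfolded invertible_def]] by (simp_all add: matrix_inv_def)

lemma matrix_inv_cancel:
  fixes M :: "real ^ 'n ^ 'n"
  assumes "invertible M"
  shows "M *v (matrix_inv M *v x) = x" "matrix_inv M *v (M *v x) = x"
  by (simp_all add: matrix_vector_mul_assoc matrix_inv_mult[OF assms])

lemma pos_def_matrix_inv:
  fixes M :: "real ^ 'n ^ 'n"
  assumes M: "pos_def_matrix M"
  shows "pos_def_matrix (matrix_inv M)"
  unfolding pos_def_matrix_def
proof (intro conjI allI impI)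
  have inv: "invertible M"
    using M by (rule pos_def_matrix_invertible)
  have sym: "transpose M = M"
    using M by (simp add: pos_def_matrix_def)
  show "transpose (matrix_inv M) = matrix_inv M"
    using symmetric_matrix_inner[OF sym, of "matrix_inv M *v x" "matrix_inv M *v y" for x y]
    by (intro symmetric_matrixI) (simp add: matrix_inv_cancel[OF inv])
  fix x :: "real ^ 'n" assume "x \<noteq> 0"
  then have "matrix_inv M *v x \<noteq> 0"
    by (metis inv matrix_inv_cancel(1) matrix_vector_mult_0_right)
  then have "0 < (matrix_inv M *v x) \<bullet> (M *v (matrix_inv M *v x))"
    using M by (simp add: pos_def_matrix_def)
  then show "0 < x \<bullet> (matrix_inv M *v x)"
    by (simp add: matrix_inv_cancel[OF inv] inner_commute)
qed

text \<open>\<open>R\<close> acts on an orthonormal eigenbasis of \<open>A\<close> by the square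
  roots of the eigenvalues, which are nonnegative by positive definiteness.\<close>

lemma pos_def_matrix_sqrt:
  fixes A :: "real ^ 'n ^ 'n"
  assumes A: "pos_def_matrix A"
  obtains R where "transpose R = R" "R ** R = A"
proof -
  obtain B where B: "finite B" "pairwise orthogonal B" "span B = UNIV"
    and B1: "\<And>b. b \<in> B \<Longrightarrow> norm b = 1" and eig: "\<And>b. b \<in> B \<Longrightarrow> \<exists>l. A *v b = l *\<^sub>R b"
    using symmetric_matrix_eigenbasis[of A] A unfolding pos_def_matrix_def by blast
  \<comment> \<open>On a unit eigenvector the quadratic form equals the eigenvalue, so
    \<open>l\<close> names all eigenvalues at once without a choice.\<close>
  define l where "l b = b \<bullet> (A *v b)" for b
  have Ab: "A *v b = l b *\<^sub>R b" and l0: "l b \<ge> 0" if "b \<in> B" for b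
  proof -
    obtain c where c: "A *v b = c *\<^sub>R b"
      using eig \<open>b \<in> B\<close> by blast
    then show "A *v b = l b *\<^sub>R b"
      using B1[OF \<open>b \<in> B\<close>] by (simp add: l_def dot_square_norm)
    have "b \<noteq> 0"
      using B1[OF \<open>b \<in> B\<close>] by auto
    then show "l b \<ge> 0"
      using A by (simp add: l_def pos_def_matrix_def less_imp_le)
  qed
  have dot: "b \<bullet> c = (if b = c then 1 else 0)" if "b \<in> B" "c \<in> B" for b c
    using B(2) B1 that by (auto simp: pairwise_def orthogonal_def dot_square_norm)
  have expand: "(\<Sum>b\<in>B. (x \<bullet> b) *\<^sub>R b) = x" for x
    using B B1 by (intro orthonormal_basis_expand) auto
  define r where "r x = (\<Sum>b\<in>B. (sqrt (l b) * (x \<bullet> b)) *\<^sub>R b)" for x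
  have lin: "linear r"
    unfolding r_def by (intro linearI) (simp_all add: inner_add_left algebra_simps sum.distrib scaleR_sum_right)
  have rb: "r x \<bullet> c = sqrt (l c) * (x \<bullet> c)" if "c \<in> B" for x c
    using that B(1) by (simp add: r_def inner_sum_left dot if_distrib cong: if_cong)
  have sa: "r x \<bullet> y = x \<bullet> r y" for x y
    unfolding r_def by (simp add: inner_sum_left inner_sum_right inner_commute mult_ac)
  have rr: "r (r x) = A *v x" for x
  proof -
    have "A *v x = A *v (\<Sum>b\<in>B. (x \<bullet> b) *\<^sub>R b)"
      by (simp add: expand)
    also have "\<dots> = (\<Sum>b\<in>B. (x \<bullet> b) *\<^sub>R (A *v b))"
      by (simp add: linear_sum linear_scale)
    also have "\<dots> = (\<Sum>b\<in>B. (l b * (x \<bullet> b)) *\<^sub>R b)"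
      by (intro sum.cong) (simp_all add: Ab mult.commute)
    also have "\<dots> = (\<Sum>b\<in>B. (sqrt (l b) * (r x \<bullet> b)) *\<^sub>R b)"
      by (intro sum.cong) (simp_all add: rb l0 flip: mult.assoc)
    also have "\<dots> = r (r x)"
      by (simp add: r_def)
    finally show ?thesis by simp
  qed
  have mv: "matrix r *v x = r x" for x
    by (simp add: lin)
  have "matrix r ** matrix r = A"
    by (simp add: matrix_eq mv rr flip: matrix_vector_mul_assoc)
  moreover have "transpose (matrix r) = matrix r"
    by (rule symmetric_matrixI) (simp add: mv sa)
  ultimately show ?thesis
    using that by blast
qed

text \<open>With \<open>R\<close> the symmetric square root of \<open>D\<close> and \<open>K\<close>
  its inverse, \<open>K ** A ** K\<close> is symmetric. Its orthonormal eigenvectors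
  \<open>c\<close> become \<open>K *v c\<close>: the map \<open>K\<close> turns the Euclidean inner
  product into the one given by \<open>D\<close>, and the eigenvalue equation into the generalized
  one for the pair \<open>A\<close>, \<open>D\<close>.\<close>

lemma pos_def_simultaneous_diagonalization:
  fixes A D :: "real ^ 'n ^ 'n"
  assumes A: "transpose A = A" and D: "pos_def_matrix D"
  obtains B where "finite B" "span B = UNIV" "pairwise (\<lambda>x y. x \<bullet> (D *v y) = 0) B"
    "\<And>b. b \<in> B \<Longrightarrow> b \<noteq> 0" "\<And>b. b \<in> B \<Longrightarrow> \<exists>l. A *v b = l *\<^sub>R (D *v b)"
proof -
  obtain R where R: "transpose R = R" "R ** R = D"
    using pos_def_matrix_sqrt[OF D] .
  have "det R * det R = det D"
    using R(2) by (metis det_mul)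
  then have invR: "invertible R"
    using pos_def_matrix_invertible[OF D] by (auto simp: invertible_det_nz)
  define K where "K = matrix_inv R"
  have KR: "K *v (R *v x) = x" "R *v (K *v x) = x" for x
    using matrix_inv_cancel[OF invR] by (simp_all add: K_def)
  have Dx: "D *v x = R *v (R *v x)" for x
    using R(2) by (simp add: matrix_vector_mul_assoc)
  have "K ** R = mat 1"
    using matrix_inv_mult(2)[OF invR] by (simp add: K_def)
  \<comment> \<open>Transposing shows that \<open>transpose K\<close> is a right inverse of
    \<open>R\<close>; it must coincide with the left inverse \<open>K\<close>.\<close>
  then have "R ** transpose K = mat 1"
    using R(1) by (metis matrix_transpose_mul transpose_mat)
  then have Ksym: "transpose K = K"
    by (metis K_def invR matrix_inv_mult(2) matrix_mul_assoc matrix_mul_lid matrix_mul_rid)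
  obtain C where C: "finite C" "pairwise orthogonal C" "span C = UNIV"
    "\<forall>b\<in>C. norm b = 1 \<and> (\<exists>l. (K ** A ** K) *v b = l *\<^sub>R b)"
    using symmetric_matrix_eigenbasis[of "K ** A ** K"] A Ksym
    by (auto simp: matrix_transpose_mul matrix_mul_assoc)
  show ?thesis
  proof
    show "finite ((*v) K ` C)"
      using C(1) by simp
    show "span ((*v) K ` C) = UNIV"
      using C(3) KR by (metis linear_span_image matrix_vector_mul_linear surjI)
    show "pairwise (\<lambda>x y. x \<bullet> (D *v y) = 0) ((*v) K ` C)"
    proof (clarsimp simp: pairwise_def)
      fix x y assume "x \<in> C" "y \<in> C" "K *v x \<noteq> K *v y"
      then have "x \<bullet> y = 0"
        using C(2) by (auto simp: pairwise_def orthogonal_def)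
      then show "(K *v x) \<bullet> (D *v (K *v y)) = 0"
        using symmetric_matrix_inner[OF Ksym] by (simp add: Dx KR)
    qed
    fix b assume "b \<in> (*v) K ` C"
    then obtain c where c: "c \<in> C" "b = K *v c" by blast
    show "b \<noteq> 0"
      using C(4) c KR by (metis matrix_vector_mult_0_right norm_zero zero_neq_one)
    obtain l where "(K ** A ** K) *v c = l *\<^sub>R c"
      using C(4) c(1) by blast
    then have "K *v (A *v b) = l *\<^sub>R c"
      using c by (simp add: matrix_vector_mul_assoc matrix_mul_assoc)
    then have "A *v b = l *\<^sub>R (D *v b)"
      unfolding Dx c(2) KR by (metis KR(2) matrix_vector_mult_scaleR)
    then show "\<exists>l. A *v b = l *\<^sub>R (D *v b)" by blast
  qed
qed

section \<open>Elliptical densities as functions of quadratic forms\<close>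

lemma pos_def_matrix_inv_sqrt:
  fixes M :: "real ^ 'n ^ 'n"
  assumes M: "pos_def_matrix M"
  obtains R where "transpose R = R" "R ** R = matrix_inv M" "det R \<noteq> 0"
proof -
  obtain R where R: "transpose R = R" "R ** R = matrix_inv M"
    using pos_def_matrix_sqrt[OF pos_def_matrix_inv[OF M]] .
  have "det R * det R = det (matrix_inv M)"
    using R(2) by (metis det_mul)
  then have "det R \<noteq> 0"
    using pos_def_matrix_invertible[OF pos_def_matrix_inv[OF M]] by (auto simp: invertible_det_nz)
  with R show ?thesis
    by (rule that)
qed

text \<open>For \<open>R\<close> the square root of \<open>matrix_inv M\<close>, the norm of
  \<open>R *v x\<close> is the square root of the quadratic form, and the factor
  \<open>\<bar>det R\<bar>\<close> is a positive constant. The same \<open>h\<close> serves every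
  \<open>p\<close> and \<mu>, so that all members of the family with one scale matrix share one
  profile.\<close>

lemma radial_function_quadratic_form:
  fixes M :: "real ^ 'n ^ 'n"
  assumes M: "pos_def_matrix M" and g: "strict_antimono_on {0..} g"
  obtains h where "strict_antimono_on {0..} h"
    "\<And>p \<mu> z. radial_function p \<mu> M g \<Longrightarrow> p z = h ((z - \<mu>) \<bullet> (matrix_inv M *v (z - \<mu>)))"
proof -
  obtain R where R: "transpose R = R" "R ** R = matrix_inv M" "det R \<noteq> 0"
    using pos_def_matrix_inv_sqrt[OF M] .
  then have det: "\<bar>det R\<bar> > 0"
    by simp
  show ?thesis
  proof
    show "strict_antimono_on {0..} (\<lambda>s. g (sqrt s) * \<bar>det R\<bar>)"
      using g det by (auto simp: monotone_on_def)
    fix p \<mu> z assume "radial_function p \<mu> M g"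
    then have "p z = g (norm (R *v (z - \<mu>))) * \<bar>det R\<bar>"
      using R by (simp add: radial_function_def)
    moreover have "norm (R *v x) = sqrt (x \<bullet> (matrix_inv M *v x))" for x
      using symmetric_matrix_inner[OF R(1), of x "R *v x"] R(2)
      by (simp add: norm_eq_sqrt_inner matrix_vector_mul_assoc)
    ultimately show "p z = g (sqrt ((z - \<mu>) \<bullet> (matrix_inv M *v (z - \<mu>)))) * \<bar>det R\<bar>"
      by simp
  qed
qed

section \<open>Invariance of Lebesgue measure under linear involutions\<close>

lemma nn_integral_lborel_translate:
  fixes c :: "'a::euclidean_space"
  assumes [measurable]: "g \<in> borel_measurable borel"
  shows "(\<integral>\<^sup>+x. g (x + c) \<partial>lborel) = (\<integral>\<^sup>+x. g x \<partial>lborel)"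
  by (subst (2) lborel_distr_plus[of c, symmetric]) (simp add: nn_integral_distr add.commute)

lemma nn_integral_lborel_reflect:
  fixes c :: "'a::euclidean_space"
  assumes [measurable]: "g \<in> borel_measurable borel"
  shows "(\<integral>\<^sup>+x. g (c - x) \<partial>lborel) = (\<integral>\<^sup>+x. g x \<partial>lborel)"
  by (subst (2) lborel_affine[of "-1" c]) (simp_all add: nn_integral_density nn_integral_distr)

text \<open>As in the uniqueness proof for Haar measure, Fubini shows that \<open>L\<close> scales the measure of all
  sets by the same factor; the \<open>L\<close>-invariant set \<open>B\<close> shows that this factor is \<open>1\<close>.\<close>

lemma lborel_distr_linear_involution:
  fixes L :: "'a::euclidean_space \<Rightarrow> 'a"
  assumes lin: "linear L" and inv: "\<And>x. L (L x) = x"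
  shows "distr lborel borel L = lborel"
proof (rule measure_eqI)
  have contL: "continuous_on S L" for S
    using lin by (intro linear_continuous_on) (simp add: linear_conv_bounded_linear)
  have L[measurable]: "L \<in> borel_measurable borel"
    by (intro borel_measurable_continuous_onI contL)
  \<comment> \<open>The intersection is invariant because \<open>L\<close> is an involution. It is
    open, bounded and contains 0, so its measure is positive and finite and can be cancelled at the
    end.\<close>
  define B where "B = ball 0 1 \<inter> L -` ball 0 1"
  have openB: "open B"
    unfolding B_def using contL[of UNIV] by (intro open_Int open_vimage) auto
  then have [measurable]: "B \<in> sets borel"
    by simp
  have LB: "L x \<in> B \<longleftrightarrow> x \<in> B" for x
    using inv by (auto simp: B_def)
  have "0 \<in> B"
    using lin by (simp add: B_def linear_0)
  then have B0: "emeasure lborel B \<noteq> 0"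
    using open_not_negligible[OF openB] by (auto simp: negligible_iff_null_sets null_sets_def)
  have Bfin: "emeasure lborel B \<noteq> \<infinity>"
    using emeasure_bounded_finite[of B] bounded_ball[of 0 1] by (simp add: B_def bounded_Int less_top)
  fix A assume "A \<in> sets (distr lborel borel L)"
  then have [measurable]: "A \<in> sets borel"
    by simp
  have "emeasure (distr lborel borel L) A * emeasure lborel B =
      (\<integral>\<^sup>+x. indicator A (L x) * emeasure lborel B \<partial>lborel)"
    by (simp add: nn_integral_multc nn_integral_distr flip: nn_integral_indicator)
  also have "\<dots> = (\<integral>\<^sup>+x. \<integral>\<^sup>+y. indicator A (L x) * indicator B (y + L x) \<partial>lborel \<partial>lborel)"
    by (simp add: nn_integral_cmult nn_integral_lborel_translate)
  also have "\<dots> = (\<integral>\<^sup>+y. \<integral>\<^sup>+x. indicator A (L x) * indicator B (y + L x) \<partial>lborel \<partial>lborel)"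
    by (intro lborel_pair.Fubini') simp
  \<comment> \<open>The shift of \<open>x\<close> by \<open>- L y\<close> turns
    \<open>y + L x\<close> into \<open>L x\<close>, and the invariance of \<open>B\<close> then
    removes \<open>L\<close> from its indicator.\<close>
  also have "\<dots> = (\<integral>\<^sup>+y. \<integral>\<^sup>+x. indicator A (L (x + - L y)) * indicator B (y + L (x + - L y)) \<partial>lborel \<partial>lborel)"
    by (subst nn_integral_lborel_translate[where g = "\<lambda>x. indicator A (L x) * indicator B (y + L x)" for y]) simp_all
  also have "\<dots> = (\<integral>\<^sup>+y. \<integral>\<^sup>+x. indicator A (L x - y) * indicator B x \<partial>lborel \<partial>lborel)"
    using lin by (simp add: linear_diff inv indicator_def LB)
  also have "\<dots> = (\<integral>\<^sup>+x. \<integral>\<^sup>+y. indicator A (L x - y) * indicator B x \<partial>lborel \<partial>lborel)"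
    by (intro lborel_pair.Fubini'[symmetric]) simp
  also have "\<dots> = emeasure lborel A * emeasure lborel B"
    by (simp add: nn_integral_multc nn_integral_cmult nn_integral_lborel_reflect)
  finally have "emeasure lborel B * emeasure (distr lborel borel L) A = emeasure lborel B * emeasure lborel A"
    by (simp only: mult.commute)
  then show "emeasure (distr lborel borel L) A = emeasure lborel A"
    using B0 Bfin by (simp add: ennreal_mult_cancel_left)
qed simp

section \<open>Submodularity and the divergence\<close>

lemma strictly_convex_erealD:
  fixes f :: "real \<Rightarrow> ereal"
  assumes "strictly_convex_ereal f" and fin: "\<And>u. u > 0 \<Longrightarrow> \<bar>f u\<bar> \<noteq> \<infinity>"
    and "x > 0" "y > 0" "x \<noteq> y" "0 < t" "t < 1"
  shows "real_of_ereal (f (t * x + (1 - t) * y)) < t * real_of_ereal (f x) + (1 - t) * real_of_ereal (f y)"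
proof -
  have "f (t * x + (1 - t) * y) < ereal t * f x + ereal (1 - t) * f y"
    using assms unfolding strictly_convex_ereal_def by simp
  moreover obtain a b where "f x = ereal a" "f y = ereal b"
    using fin assms(3,4) by (metis ereal_real')
  moreover have "t * x + (1 - t) * y > 0"
    using assms by (simp add: add_pos_pos)
  then obtain c where "f (t * x + (1 - t) * y) = ereal c"
    using fin by (metis ereal_real')
  ultimately show ?thesis by simp
qed

text \<open>Both \<open>a / v\<close> and \<open>b / u\<close> lie strictly between
  \<open>x = a / u\<close> and \<open>y = b / v\<close>. Strict convexity bounds \<open>f\<close> at
  these two points by its values at \<open>x\<close> and \<open>y\<close>; weighted by
  \<open>v\<close> and \<open>u\<close>, the coefficients add up to exactly \<open>u\<close> at
  \<open>x\<close> and \<open>v\<close> at \<open>y\<close>.\<close>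

lemma perspective_strictly_submodular:
  fixes f :: "real \<Rightarrow> ereal"
  defines "\<Phi> \<equiv> \<lambda>a u. real_of_ereal (f (a / u)) * u"
  assumes conv: "strictly_convex_ereal f" and fin: "\<And>u. u > 0 \<Longrightarrow> \<bar>f u\<bar> \<noteq> \<infinity>"
    and ab: "0 < a" "a < b" and vu: "0 < v" "v < u"
  shows "\<Phi> a v + \<Phi> b u < \<Phi> a u + \<Phi> b v"
proof -
  define x y where "x = a / u" and "y = b / v"
  have u: "u > 0" using vu by simp
  have x: "x > 0" "u * x = a" and y: "y > 0" "v * y = b"
    using ab vu by (simp_all add: x_def y_def)
  have av: "x < a / v" "a / v < y" and bu: "x < b / u" "b / u < y"
    using ab vu by (simp_all add: x_def y_def divide_strict_right_mono divide_strict_left_mono)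
  have xy: "x < y" using av by simp
  define t s where "t = (y - a / v) / (y - x)" and "s = (y - b / u) / (y - x)"
  have t: "0 < t" "t < 1" and s: "0 < s" "s < 1"
    using av bu xy by (simp_all add: t_def s_def)
  have "t * (y - x) = y - a / v" "s * (y - x) = y - b / u"
    using xy by (simp_all add: t_def s_def)
  then have eqs: "t * x + (1 - t) * y = a / v" "s * x + (1 - s) * y = b / u"
    by (simp_all add: algebra_simps)
  \<comment> \<open>The total coefficient of \<open>f x\<close>, multiplied by \<open>y - x\<close>
    so that the definitions of \<open>t\<close> and \<open>s\<close> apply. It rests on
    \<open>u * x = a\<close> and \<open>v * y = b\<close>.\<close>
  have "(v * t + u * s) * (y - x) = u * (y - x)"
  proof -
    have "(v * t + u * s) * (y - x) = v * (t * (y - x)) + u * (s * (y - x))"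
      by (simp add: algebra_simps)
    also have "\<dots> = v * (y - a / v) + u * (y - b / u)"
      using xy by (simp add: t_def s_def)
    also have "\<dots> = u * (y - x)"
      using x y u vu by (simp add: right_diff_distrib)
    finally show ?thesis .
  qed
  then have w: "v * t + u * s = u"
    using xy by simp
  let ?\<phi> = "\<lambda>x. real_of_ereal (f x)"
  have 1: "?\<phi> (a / v) < t * ?\<phi> x + (1 - t) * ?\<phi> y"
    using strictly_convex_erealD[OF conv fin x(1) y(1) _ t] xy by (simp add: eqs)
  have 2: "?\<phi> (b / u) < s * ?\<phi> x + (1 - s) * ?\<phi> y"
    using strictly_convex_erealD[OF conv fin x(1) y(1) _ s] xy by (simp add: eqs)
  have "\<Phi> a v + \<Phi> b u < (t * ?\<phi> x + (1 - t) * ?\<phi> y) * v + (s * ?\<phi> x + (1 - s) * ?\<phi> y) * u"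
    unfolding \<Phi>_def using 1 2 u vu by (intro add_strict_mono mult_strict_right_mono) auto
  also have "\<dots> = (v * t + u * s) * ?\<phi> x + (v + u - (v * t + u * s)) * ?\<phi> y"
    by (simp add: algebra_simps)
  also have "\<dots> = \<Phi> a u + \<Phi> b v"
    unfolding w by (simp add: \<Phi>_def x_def y_def)
  finally show ?thesis .
qed

text \<open>Densities are positive, so \<open>f\<close> is only evaluated on (0, \<infinity>), where
  it is finite and, being differentiable, continuous. This allows the comparison of divergences to
  be carried out with real integrals.\<close>

lemma f_divergence_eq_integral:
  fixes p q :: "real ^ 'n \<Rightarrow> real"
  assumes f: "divergence_generator f" and p: "prob_density p" and q: "prob_density q"
    and fin: "\<bar>f_divergence f p q\<bar> \<noteq> \<infinity>"
  shows "integrable lborel (\<lambda>z. real_of_ereal (f (p z / q z)) * q z)"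
    and "f_divergence f p q = ereal (\<integral>z. real_of_ereal (f (p z / q z)) * q z \<partial>lborel)"
proof -
  define G where "G = (\<lambda>z. real_of_ereal (f (p z / q z)) * q z)"
  have pos: "p z > 0" "q z > 0" for z
    using p q by (auto simp: prob_density_def)
  have [measurable]: "p \<in> borel_measurable borel" "q \<in> borel_measurable borel"
    using p q by (auto simp: prob_density_def has_bochner_integral_iff dest: borel_measurable_integrable)
  have "continuous_on {0<..} (\<lambda>u. real_of_ereal (f u))"
    using f by (auto simp: divergence_generator_def intro: differentiable_imp_continuous_on)
  \<comment> \<open>Continuity is known only on the open half line; the indicator gives a function
    measurable on all of \<real>, and it equals 1 at the positive ratio of the densities.\<close>
  then have "(\<lambda>u. indicator {0<..} u *\<^sub>R real_of_ereal (f u)) \<in> borel_measurable borel"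
    by (intro borel_measurable_continuous_on_indicator) auto
  from measurable_compose[OF _ this, of "\<lambda>z. p z / q z" borel]
  have "(\<lambda>z. indicator {0<..} (p z / q z) *\<^sub>R real_of_ereal (f (p z / q z)) * q z) \<in> borel_measurable borel"
    by measurable
  moreover have "(\<lambda>z. indicator {0<..} (p z / q z) *\<^sub>R real_of_ereal (f (p z / q z)) * q z) = G"
    using pos by (auto simp: G_def)
  ultimately have meas: "G \<in> borel_measurable lborel"
    by simp
  have "f (p z / q z) * ereal (q z) = ereal (G z)" for z
  proof -
    have "\<bar>f (p z / q z)\<bar> \<noteq> \<infinity>"
      using f pos by (simp add: divergence_generator_def)
    then obtain c where "f (p z / q z) = ereal c"
      by (metis ereal_real')
    then show ?thesis
      by (simp add: G_def)
  qed
  then have div: "f_divergence f p q =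
      enn2ereal (\<integral>\<^sup>+z. ennreal (G z) \<partial>lborel) - enn2ereal (\<integral>\<^sup>+z. ennreal (- G z) \<partial>lborel)"
    by (simp add: f_divergence_def e2ennreal_ereal)
  \<comment> \<open>An infinite positive part makes the difference \<infinity> even if the negative
    part is infinite too, and an infinite negative part alone makes it -\<infinity>.\<close>
  have "(\<integral>\<^sup>+z. ennreal (G z) \<partial>lborel) \<noteq> \<infinity>" "(\<integral>\<^sup>+z. ennreal (- G z) \<partial>lborel) \<noteq> \<infinity>"
    using fin unfolding div
    by (cases rule: ennreal2_cases[of "\<integral>\<^sup>+z. ennreal (G z) \<partial>lborel" "\<integral>\<^sup>+z. ennreal (- G z) \<partial>lborel"]; simp)+
  then have int: "integrable lborel G"
    and fin': "(\<integral>\<^sup>+z. ennreal (G z) \<partial>lborel) \<noteq> \<infinity>" "(\<integral>\<^sup>+z. ennreal (- G z) \<partial>lborel) \<noteq> \<infinity>"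
    using meas by (simp_all add: real_integrable_def)
  then show "integrable lborel (\<lambda>z. real_of_ereal (f (p z / q z)) * q z)"
    by (simp add: G_def)
  have "f_divergence f p q = ereal (\<integral>z. G z \<partial>lborel)"
    unfolding div real_lebesgue_integral_def[OF int] using fin'
    by (cases rule: ennreal2_cases[of "\<integral>\<^sup>+z. ennreal (G z) \<partial>lborel" "\<integral>\<^sup>+z. ennreal (- G z) \<partial>lborel"]) simp_all
  then show "f_divergence f p q = ereal (\<integral>z. real_of_ereal (f (p z / q z)) * q z \<partial>lborel)"
    by (simp add: G_def)
qed

section \<open>Decrease of the divergence when one component of the location is removed\<close>

lemma quadratic_form_add_orthogonal:
  fixes A :: "real ^ 'n ^ 'n"
  assumes "transpose A = A" "w \<bullet> (A *v e) = 0"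
  shows "(w + t *\<^sub>R e) \<bullet> (A *v (w + t *\<^sub>R e)) = w \<bullet> (A *v w) + t\<^sup>2 * (e \<bullet> (A *v e))"
  using assms(2) symmetric_matrix_inner[OF assms(1), of w e]
  by (simp add: matrix_vector_right_distrib inner_add inner_commute power2_eq_square algebra_simps
      matrix_vector_mult_scaleR)

text \<open>Polarization: the oblique reflection \<open>\<sigma>\<close> along \<open>e\<close> that swaps \<open>\<nu>\<close> and \<open>\<nu>'\<close> preserves Lebesgue
  measure and swaps \<open>q\<close> and \<open>q'\<close>. Where \<open>p\<close> decreases under \<open>\<sigma>\<close>, so does \<open>q'\<close>, whereas \<open>q\<close> increases;
  strict submodularity of \<open>(a, u) \<mapsto> u f(a / u)\<close> then compares the integrands at \<open>z\<close> and \<open>\<sigma> z\<close>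
  together.\<close>

lemma f_divergence_less_of_remove_eigencomponent:
  fixes A D :: "real ^ 'n ^ 'n"
  assumes f: "divergence_generator f" "strictly_convex_ereal f"
    and A: "pos_def_matrix A" and D: "pos_def_matrix D"
    and e: "e \<noteq> 0" "A *v e = l *\<^sub>R (D *v e)"
    and orth: "(\<nu>' - \<mu>) \<bullet> (D *v e) = 0" and \<nu>: "\<nu> = \<nu>' + \<alpha> *\<^sub>R e" and \<alpha>: "\<alpha> \<noteq> 0"
    and h: "strict_antimono_on {0..} h" and p: "\<And>z. p z = h ((z - \<mu>) \<bullet> (A *v (z - \<mu>)))"
    and k: "strict_antimono_on {0..} k" and q: "\<And>z. q z = k ((z - \<nu>) \<bullet> (D *v (z - \<nu>)))"
    and q': "\<And>z. q' z = k ((z - \<nu>') \<bullet> (D *v (z - \<nu>')))"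
    and dens: "prob_density p" "prob_density q" "prob_density q'"
    and fin: "\<bar>f_divergence f p q\<bar> \<noteq> \<infinity>" "\<bar>f_divergence f p q'\<bar> \<noteq> \<infinity>"
  shows "f_divergence f p q' < f_divergence f p q"
proof -
  have ffin: "\<bar>f u\<bar> \<noteq> \<infinity>" if "u > 0" for u
    using f(1) that by (simp add: divergence_generator_def)
  have symA: "transpose A = A" and symD: "transpose D = D"
    using A D by (simp_all add: pos_def_matrix_def)
  define N where "N = e \<bullet> (D *v e)"
  have N: "N > 0" and lN: "l * N > 0" and eA: "e \<bullet> (A *v e) = l * N"
    using A D e by (auto simp: N_def pos_def_matrix_def)
  have A0: "0 \<le> x \<bullet> (A *v x)" and D0: "0 \<le> x \<bullet> (D *v x)" for x
    using A D by (cases "x = 0"; simp add: pos_def_matrix_def less_imp_le)+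
  \<comment> \<open>\<open>t z\<close> is the coordinate of \<open>z - \<nu>'\<close> along
    \<open>e\<close> for the inner product of \<open>D\<close>, and \<open>w z\<close> is the part
    orthogonal to \<open>e\<close>. The reflection \<sigma> fixes \<open>w\<close> and sends
    \<open>t\<close> to \<open>\<alpha> - t\<close>.\<close>
  define t where "t z = ((z - \<nu>') \<bullet> (D *v e)) / N" for z
  define w where "w z = z - \<nu>' - t z *\<^sub>R e" for z
  define \<sigma> where "\<sigma> z = z + (\<alpha> - 2 * t z) *\<^sub>R e" for z
  have wD: "w z \<bullet> (D *v e) = 0" for z
    using N by (simp add: w_def t_def inner_diff_left flip: N_def)
  \<comment> \<open>Since \<open>A *v e\<close> is a multiple of \<open>D *v e\<close>,
    orthogonality for \<open>D\<close> carries over to \<open>A\<close>. With \<open>orth\<close>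
    this makes \<open>p\<close>, although centred at \<mu>, an even function of
    \<open>t\<close>.\<close>
  have w'A: "(w z + (\<nu>' - \<mu>)) \<bullet> (A *v e) = 0" for z
    using wD[of z] orth by (simp add: e(2) inner_add_left)
  have t\<sigma>: "t (\<sigma> z) = \<alpha> - t z" for z
    using N by (simp add: t_def \<sigma>_def inner_add_left inner_diff_left field_simps flip: N_def)
  have w\<sigma>: "w (\<sigma> z) = w z" for z
  proof -
    have "(\<alpha> - 2 * t z) *\<^sub>R e = (\<alpha> - t z) *\<^sub>R e - t z *\<^sub>R e"
      by (simp flip: scaleR_left_diff_distrib)
    then show ?thesis
      unfolding w_def t\<sigma> by (simp add: \<sigma>_def)
  qed
  \<comment> \<open>For fixed \<open>w\<close>, both \<open>p\<close> and \<open>q'\<close> decrease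
    strictly in the square of \<open>t\<close>, and \<open>q\<close> in that of
    \<open>t - \<alpha>\<close>.\<close>
  have pz: "p z = h ((w z + (\<nu>' - \<mu>)) \<bullet> (A *v (w z + (\<nu>' - \<mu>))) + (t z)\<^sup>2 * (l * N))" for z
    using quadratic_form_add_orthogonal[OF symA w'A, of z "t z"] by (simp add: p w_def eA)
  have q'z: "q' z = k (w z \<bullet> (D *v w z) + (t z)\<^sup>2 * N)" for z
    using quadratic_form_add_orthogonal[OF symD wD, of z "t z"] by (simp add: q' w_def N_def)
  have qz: "q z = k (w z \<bullet> (D *v w z) + (t z - \<alpha>)\<^sup>2 * N)" for z
  proof -
    have "z - \<nu> = w z + (t z - \<alpha>) *\<^sub>R e"
      by (simp add: w_def \<nu> scaleR_left_diff_distrib)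
    then show ?thesis
      using quadratic_form_add_orthogonal[OF symD wD, of z "t z - \<alpha>"] by (simp add: q N_def)
  qed
  have swap: "q (\<sigma> z) = q' z" "q' (\<sigma> z) = q z" for z
    by (simp_all add: qz q'z t\<sigma> w\<sigma> power2_commute)

  have antimono: "g (x + s * c) > g (x + s' * c)"
    if "strict_antimono_on {0..} g" "x \<ge> 0" "c > 0" "0 \<le> s" "s < s'" for g :: "real \<Rightarrow> real" and x c s s'
    using that by (intro monotone_onD[OF that(1)]) auto
  define \<Phi> where "\<Phi> a u = real_of_ereal (f (a / u)) * u" for a u
  define \<Delta> where "\<Delta> z = \<Phi> (p z) (q z) - \<Phi> (p z) (q' z)" for z
  have pos: "p z > 0" "q z > 0" "q' z > 0" for z
    using dens by (auto simp: prob_density_def)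
  have submod: "\<Phi> a v + \<Phi> b u < \<Phi> a u + \<Phi> b v" if "0 < a" "a < b" "0 < v" "v < u" for a b u v
    unfolding \<Phi>_def using that by (intro perspective_strictly_submodular f(2) ffin) auto
  \<comment> \<open>As \<sigma> swaps \<open>q\<close> and \<open>q'\<close>, the sum over the pair
    \<open>z\<close>, \<open>\<sigma> z\<close> has the shape of the submodularity
    inequality.\<close>
  have \<Delta>\<sigma>: "\<Delta> z + \<Delta> (\<sigma> z) = (\<Phi> (p z) (q z) + \<Phi> (p (\<sigma> z)) (q' z)) - (\<Phi> (p z) (q' z) + \<Phi> (p (\<sigma> z)) (q z))" for z
    by (simp add: \<Delta>_def swap)
  have \<Delta>_pos: "\<Delta> z + \<Delta> (\<sigma> z) > 0" if "2 * t z \<noteq> \<alpha>" for z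
  proof -
    \<comment> \<open>The sign tells on which side of the mirror \<open>2 * t z = \<alpha>\<close>
      the point lies, and so which of \<open>z\<close>, \<open>\<sigma> z\<close> has the larger
      value of \<open>p\<close>.\<close>
    have "(t z)\<^sup>2 - (t z - \<alpha>)\<^sup>2 = \<alpha> * (2 * t z - \<alpha>)"
      by (simp add: power2_eq_square algebra_simps)
    then have "(t z)\<^sup>2 \<noteq> (t z - \<alpha>)\<^sup>2"
      using \<alpha> that by auto
    then consider "(t z)\<^sup>2 < (t z - \<alpha>)\<^sup>2" | "(t z - \<alpha>)\<^sup>2 < (t z)\<^sup>2"
      by linarith
    then show ?thesis
    proof cases
      case 1
      then have "p (\<sigma> z) < p z" "q z < q' z"
        unfolding pz qz q'z t\<sigma> w\<sigma> power2_commute[of \<alpha>]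
        by (intro antimono h k A0 D0 N lN zero_le_power2; assumption)+
      then show ?thesis
        using submod[of "p (\<sigma> z)" "p z" "q z" "q' z"] pos by (simp add: \<Delta>\<sigma>)
    next
      case 2
      then have "p z < p (\<sigma> z)" "q' z < q z"
        unfolding pz qz q'z t\<sigma> w\<sigma> power2_commute[of \<alpha>]
        by (intro antimono h k A0 D0 N lN zero_le_power2; assumption)+
      then show ?thesis
        using submod[of "p z" "p (\<sigma> z)" "q' z" "q z"] pos by (simp add: \<Delta>\<sigma>)
    qed
  qed
  have \<Delta>_nonneg: "\<Delta> z + \<Delta> (\<sigma> z) \<ge> 0" for z
  proof (cases "2 * t z = \<alpha>")
    case True
    then have "\<sigma> z = z" "q z = q' z"
      by (simp_all add: \<sigma>_def qz q'z flip: True)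
    then show ?thesis
      by (simp add: \<Delta>_def)
  qed (simp add: \<Delta>_pos less_imp_le)

  have \<sigma>: "distr lborel borel \<sigma> = lborel"
  proof -
    \<comment> \<open>The linear part of \<sigma>: it negates \<open>e\<close> and fixes the
      hyperplane orthogonal to \<open>e\<close> for \<open>D\<close>. The vector \<open>c\<close> is
      the remaining translation.\<close>
    define L where "L z = z - (2 * (z \<bullet> (D *v e)) / N) *\<^sub>R e" for z
    define c where "c = (\<alpha> + 2 * (\<nu>' \<bullet> (D *v e)) / N) *\<^sub>R e"
    have lin: "linear L"
      unfolding L_def by (intro linearI) (simp_all add: inner_add_left algebra_simps add_divide_distrib)
    have inv: "L (L z) = z" for z
      using N by (simp add: L_def inner_diff_left field_simps flip: N_def)
    have [measurable]: "L \<in> borel_measurable borel"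
      using lin by (intro borel_measurable_continuous_onI linear_continuous_on)
        (simp add: linear_conv_bounded_linear)
    have "\<sigma> = (+) c \<circ> L"
      by (simp add: fun_eq_iff \<sigma>_def L_def c_def t_def inner_diff_left diff_divide_distrib algebra_simps)
    then have "distr lborel borel \<sigma> = distr (distr lborel borel L) borel ((+) c)"
      by (simp add: distr_distr)
    then show ?thesis
      by (simp add: lborel_distr_linear_involution[OF lin inv] lborel_distr_plus)
  qed
  have [measurable]: "\<sigma> \<in> borel_measurable borel"
    unfolding \<sigma>_def t_def by measurable
  have G: "integrable lborel (\<lambda>z. \<Phi> (p z) (q z))" "integrable lborel (\<lambda>z. \<Phi> (p z) (q' z))"
    and div: "f_divergence f p q = ereal (\<integral>z. \<Phi> (p z) (q z) \<partial>lborel)"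
      "f_divergence f p q' = ereal (\<integral>z. \<Phi> (p z) (q' z) \<partial>lborel)"
    using f_divergence_eq_integral[OF f(1) dens(1,2) fin(1)]
      f_divergence_eq_integral[OF f(1) dens(1,3) fin(2)]
    by (simp_all only: \<Phi>_def)
  have int\<Delta>: "integrable lborel \<Delta>"
    unfolding \<Delta>_def using G by (rule Bochner_Integration.integrable_diff)
  then have [measurable]: "\<Delta> \<in> borel_measurable borel"
    using borel_measurable_integrable by force
  have int\<Delta>\<sigma>: "integrable lborel (\<lambda>z. \<Delta> (\<sigma> z))"
    using int\<Delta> integrable_distr_eq[of \<sigma> lborel borel \<Delta>] by (simp add: \<sigma>)
  have "(\<integral>z. \<Delta> (\<sigma> z) \<partial>lborel) = (\<integral>z. \<Delta> z \<partial>lborel)"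
    using integral_distr[of \<sigma> lborel borel \<Delta>] by (simp add: \<sigma>)
  \<comment> \<open>Invariance of Lebesgue measure under \<sigma> reduces the sign of the integral
    of \<Delta> to that of the pair sums.\<close>
  then have eq: "(\<integral>z. \<Delta> z + \<Delta> (\<sigma> z) \<partial>lborel) = 2 * (\<integral>z. \<Delta> z \<partial>lborel)"
    using int\<Delta> int\<Delta>\<sigma> by simp
  have "(\<integral>z. \<Delta> z + \<Delta> (\<sigma> z) \<partial>lborel) \<noteq> 0"
  proof
    assume "(\<integral>z. \<Delta> z + \<Delta> (\<sigma> z) \<partial>lborel) = 0"
    then have zero: "AE z in lborel. \<Delta> z + \<Delta> (\<sigma> z) = 0"
      using int\<Delta> int\<Delta>\<sigma> \<Delta>_nonneg by (subst (asm) integral_nonneg_eq_0_iff_AE) auto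
    have "D *v e \<noteq> 0"
      using N by (auto simp: N_def)
    \<comment> \<open>This hyperplane is the mirror of \<sigma>, the only place where the pair sum
      can vanish.\<close>
    then have "negligible {z. (D *v e) \<bullet> z = \<alpha> * N / 2 + \<nu>' \<bullet> (D *v e)}"
      by (intro negligible_hyperplane) simp
    moreover have "closed {z. (D *v e) \<bullet> z = \<alpha> * N / 2 + \<nu>' \<bullet> (D *v e)}"
      by (rule closed_hyperplane)
    ultimately have "{z. (D *v e) \<bullet> z = \<alpha> * N / 2 + \<nu>' \<bullet> (D *v e)} \<in> null_sets lborel"
      by (simp add: negligible_iff_null_sets null_sets_def)
    moreover have "{z. 2 * t z = \<alpha>} = {z. (D *v e) \<bullet> z = \<alpha> * N / 2 + \<nu>' \<bullet> (D *v e)}"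
      using N by (auto simp: t_def inner_diff_left inner_commute[of "D *v e"] field_simps)
    ultimately have "AE z in lborel. 2 * t z \<noteq> \<alpha>"
      by (intro AE_I'[where N = "{z. 2 * t z = \<alpha>}"]) auto
    with zero have "AE z in (lborel :: (real ^ 'n) measure). False"
      by eventually_elim (use \<Delta>_pos in force)
    then show False
      by (simp add: ae_filter_eq_bot_iff eventually_False)
  qed
  moreover have "(\<integral>z. \<Delta> z + \<Delta> (\<sigma> z) \<partial>lborel) \<ge> 0"
    using \<Delta>_nonneg by simp
  ultimately have "(\<integral>z. \<Delta> z \<partial>lborel) > 0"
    unfolding eq by simp
  then show ?thesis
    using G by (simp add: div \<Delta>_def)
qed

text \<open>Strict unimodality speaks of a radial function for some scatter matrix of trace
  \<open>CARD('n)\<close>, which may differ from \<open>S\<close>. Comparing both representations of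
  \<open>q\<close> along one ray from \<nu> shows that the two radial functions agree up to positive
  rescalings of argument and value.\<close>

lemma radial_function_strict_antimono:
  fixes q :: "real ^ 'n \<Rightarrow> real"
  assumes S: "pos_def_matrix S" and g: "radial_function q \<nu> S g" and unimodal: "strictly_unimodal q \<nu>"
  shows "strict_antimono_on {0..} g"
proof -
  obtain M g' where M: "pos_def_matrix M" and g': "radial_function q \<nu> M g'" "strict_antimono_on {0..} g'"
    using unimodal by (auto simp: strictly_unimodal_def scatter_matrix_def)
  obtain C where C: "transpose C ** C = matrix_inv S" "det C \<noteq> 0"
    using pos_def_matrix_inv_sqrt[OF S] by metis
  obtain C' where C': "transpose C' ** C' = matrix_inv M" "det C' \<noteq> 0"
    using pos_def_matrix_inv_sqrt[OF M] by metis
  obtain x :: "real ^ 'n" where "x \<noteq> 0"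
    by (metis axis_eq_0_iff zero_neq_one)
  then have x: "norm (C *v x) > 0" "norm (C' *v x) > 0"
    using C(2) C'(2) by (metis invertible_det_nz matrix_inv_cancel(2) matrix_vector_mult_0_right zero_less_norm_iff)+
  have "g r * \<bar>det C\<bar> = g' (r / norm (C *v x) * norm (C' *v x)) * \<bar>det C'\<bar>" if "r \<ge> 0" for r
  proof -
    let ?z = "\<nu> + (r / norm (C *v x)) *\<^sub>R x"
    have "q ?z = g (norm (C *v (?z - \<nu>))) * \<bar>det C\<bar>" "q ?z = g' (norm (C' *v (?z - \<nu>))) * \<bar>det C'\<bar>"
      using g g'(1) C(1) C'(1) unfolding radial_function_def by blast+
    then show ?thesis
      using that x by (simp add: matrix_vector_mult_scaleR)
  qed
  then have eq: "g r = g' (r / norm (C *v x) * norm (C' *v x)) * (\<bar>det C'\<bar> / \<bar>det C\<bar>)" if "r \<ge> 0" for r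
    using C(2) that by (simp add: field_simps)
  show ?thesis
  proof (rule monotone_onI)
    fix r s :: real assume "r \<in> {0..}" "s \<in> {0..}" "r < s"
    then have "g' (s / norm (C *v x) * norm (C' *v x)) < g' (r / norm (C *v x) * norm (C' *v x))"
      using x by (intro monotone_onD[OF g'(2)]) (auto intro!: mult_strict_right_mono divide_strict_right_mono)
    then show "g s < g r"
      using \<open>r \<in> _\<close> \<open>s \<in> _\<close> C(2) C'(2) by (simp add: eq divide_strict_right_mono mult_strict_right_mono)
  qed
qed

section \<open>Descent through the components of \<open>\<nu> - \<mu>\<close>\<close>

theorem theorem1:
  fixes f :: "real \<Rightarrow> ereal"
    and p :: "real ^ 'n \<Rightarrow> real"
    and \<mu> :: "real ^ 'n"
    and g\<^sub>q :: "real \<Rightarrow> real"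
    and q :: "real ^ 'n \<Rightarrow> real ^ 'n ^ 'n \<Rightarrow> real ^ 'n \<Rightarrow> real"
  assumes "divergence_generator f"
    and "strictly_convex_ereal f"
    and "prob_density p"
    and "p differentiable_on UNIV"
    and "elliptically_symmetric p \<mu>"
    and "elliptical_location_scale_family g\<^sub>q q"
    and "\<And>\<nu> S. pos_def_matrix S \<Longrightarrow> \<bar>f_divergence f p (q \<nu> S)\<bar> \<noteq> \<infinity>"
    and "locally_dominated_partials f p g\<^sub>q"
    and "strictly_unimodal p \<mu>"
    and "\<And>\<nu> S. pos_def_matrix S \<Longrightarrow> strictly_unimodal (q \<nu> S) \<nu>"
  shows "\<forall>S. pos_def_matrix S \<longrightarrow>
    (\<forall>\<nu>. is_arg_min (\<lambda>\<nu>'. f_divergence f p (q \<nu>' S)) (\<lambda>_. True) \<nu> \<longleftrightarrow> \<nu> = \<mu>)"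
proof (intro allI impI)
  fix S :: "real ^ 'n ^ 'n" and \<nu>\<^sub>0 :: "real ^ 'n"
  assume S: "pos_def_matrix S"
  have q: "prob_density (q \<nu> S)" "radial_function (q \<nu> S) \<nu> S g\<^sub>q" for \<nu>
    using assms(6) S by (auto simp: elliptical_location_scale_family_def)
  obtain M g where M: "pos_def_matrix M" and g: "radial_function p \<mu> M g" "strict_antimono_on {0..} g"
    using assms(9) by (auto simp: strictly_unimodal_def scatter_matrix_def)
  define A D where "A = matrix_inv M" and "D = matrix_inv S"
  have A: "pos_def_matrix A" and D: "pos_def_matrix D"
    using M S by (simp_all add: A_def D_def pos_def_matrix_inv)
  obtain h where h: "strict_antimono_on {0..} h" "\<And>z. p z = h ((z - \<mu>) \<bullet> (A *v (z - \<mu>)))"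
    using radial_function_quadratic_form[OF M g(2)] g(1) unfolding A_def by metis
  have "strict_antimono_on {0..} g\<^sub>q"
    using radial_function_strict_antimono[OF S q(2) assms(10)[OF S]] .
  then obtain k where k: "strict_antimono_on {0..} k"
      "\<And>\<nu> z. q \<nu> S z = k ((z - \<nu>) \<bullet> (D *v (z - \<nu>)))"
    using radial_function_quadratic_form[OF S] q(2) unfolding D_def by metis
  obtain B where B: "finite B" "span B = UNIV" "pairwise (\<lambda>x y. x \<bullet> (D *v y) = 0) B"
    "\<And>b. b \<in> B \<Longrightarrow> b \<noteq> 0" "\<And>b. b \<in> B \<Longrightarrow> \<exists>l. A *v b = l *\<^sub>R (D *v b)"
    using pos_def_simultaneous_diagonalization[OF _ D, of A] A unfolding pos_def_matrix_def by metis
  let ?F = "\<lambda>\<nu>. f_divergence f p (q \<nu> S)"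
  have step: "?F \<nu>' < ?F (\<nu>' + c *\<^sub>R b)"
    if "b \<in> B" "c \<noteq> 0" "(\<nu>' - \<mu>) \<bullet> (D *v b) = 0" for \<nu>' c b
  proof -
    obtain l where "A *v b = l *\<^sub>R (D *v b)"
      using B(5) \<open>b \<in> B\<close> by blast
    then show ?thesis
      using f_divergence_less_of_remove_eigencomponent[OF assms(1,2) A D B(4)[OF that(1)] _ that(3) refl that(2) h k(1)
          k(2) k(2) assms(3) q(1) q(1) assms(7)[OF S] assms(7)[OF S]] by blast
  qed
  \<comment> \<open>The components are added one at a time. The vectors of \<open>J\<close> are
    orthogonal to the new \<open>b\<close> for \<open>D\<close>, so \<open>step\<close> applies to
    the partial sum. The weak inequality covers vanishing coefficients; a single nonzero one makes
    it strict.\<close>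
  have descent: "?F \<mu> \<le> ?F (\<mu> + (\<Sum>b\<in>J. c b *\<^sub>R b)) \<and>
      ((\<exists>b\<in>J. c b \<noteq> 0) \<longrightarrow> ?F \<mu> < ?F (\<mu> + (\<Sum>b\<in>J. c b *\<^sub>R b)))" if "finite J" "J \<subseteq> B" for J c
    using that
  proof (induction J rule: finite_induct)
    case (insert b J)
    let ?\<nu> = "\<mu> + (\<Sum>b\<in>J. c b *\<^sub>R b)"
    have "a \<bullet> (D *v b) = 0" if "a \<in> J" for a
      using B(3) insert that by (auto simp: pairwise_def)
    then have "(?\<nu> - \<mu>) \<bullet> (D *v b) = 0"
      by (simp add: inner_sum_left)
    then have "?F ?\<nu> < ?F (?\<nu> + c b *\<^sub>R b)" if "c b \<noteq> 0"
      using step insert.prems that by blast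
    moreover have sum: "\<mu> + (\<Sum>b\<in>insert b J. c b *\<^sub>R b) = ?\<nu> + c b *\<^sub>R b"
      using insert.hyps by (simp add: add_ac)
    moreover have "?F \<mu> \<le> ?F ?\<nu>"
      using insert.IH insert.prems by blast
    ultimately show ?case
      using insert.IH insert.prems unfolding sum
      by (cases "c b = 0") (auto dest: le_less_trans intro: less_imp_le)
  qed simp
  \<comment> \<open>Expanding \<open>\<nu> - \<mu>\<close> in \<open>B\<close> gives at least one
    nonzero coefficient. This strict inequality yields both that \<mu> is a minimizer and that no
    other point is.\<close>
  have less: "?F \<mu> < ?F \<nu>" if "\<nu> \<noteq> \<mu>" for \<nu>
  proof -
    have "\<nu> - \<mu> \<in> span B"
      using B(2) by simp
    then obtain c where c: "\<nu> - \<mu> = (\<Sum>b\<in>B. c b *\<^sub>R b)"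
      using B(1) by (auto simp: span_finite)
    then have "\<nu> = \<mu> + (\<Sum>b\<in>B. c b *\<^sub>R b)"
      by (simp add: algebra_simps)
    moreover have "\<exists>b\<in>B. c b \<noteq> 0"
      by (rule ccontr) (use c that in simp)
    ultimately show ?thesis
      using descent[OF B(1) order_refl] by metis
  qed
  then show "is_arg_min ?F (\<lambda>_. True) \<nu>\<^sub>0 \<longleftrightarrow> \<nu>\<^sub>0 = \<mu>"
    unfolding is_arg_min_def by (metis less_asym less_irrefl)
qed

end
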